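(* Let $p>7408848$ be a prime and let $P\in\mathbb{F}_p[x]$ be a polynomial of degree $\frac{p-1}{2}$ with $\sum_{x\in\mathbb{F}_p}P(x)=p$ (values regarded as integers in $\{0,\dots,p-1\}$, sum in $\mathbb{Z}$). Then the leading coefficient of $P$ is one of $1,-1,\frac{p-1}{2},-\frac{p-1}{2}$ (as elements of $\mathbb{F}_p$).
   Context: Elements of $\mathbb{F}_p$ are identified with the integers $\{0,1,\dots,p-1\}$. *)

theory Defs
  imports "Berlekamp_Zassenhaus.Finite_Field" "HOL-Computational_Algebra.Polynomial"
begin

end

theory Submission
  imports Defs "Berlekamp_Zassenhaus.Berlekamp_Type_Based"
begin

text \<open>
  Let \<open>f\<close> be the integer valued lift of \<open>P\<close>, \<open>F = \<Prod>x. (X - x) ^ f x\<close>, \<open>D = X ^ p - X\<close> and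
  \<open>h = F - D\<close>. As \<open>deg P < p\<close>, partial fractions give \<open>F' D = - P F\<close>, hence \<open>h F' = F (F' + P)\<close>.
  Comparing degrees, \<open>F'\<close> has degree \<open>(p - 1) / 2\<close>, \<open>h\<close> has degree \<open>(p + 1) / 2\<close> and \<open>F' + P\<close> is
  the constant \<open>a = 2 c\<^sup>2\<close>, where \<open>c\<close> is the leading coefficient of \<open>P\<close>. Differentiating
  \<open>F' D = - P F\<close> yields \<open>h P' = (a - P) (1 - P)\<close>. At a point where \<open>P\<close> does not vanish, \<open>h\<close> does,
  so \<open>P \<in> {1, a}\<close> there, and differentiating once more gives \<open>(2 + 2 a - 3 P) P' = 0\<close>.
  Unless \<open>a = 2\<close> or \<open>2 a = 1\<close>, \<open>P'\<close> would vanish at all of these points, of which there are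
  at least \<open>(p + 1) / 2 > deg P'\<close>.
\<close>

lemma of_nat_to_int_mod_ring:
  "of_nat (nat (to_int_mod_ring x)) = (x :: 'p::prime_card mod_ring)"
proof -
  have "to_int_mod_ring x \<ge> 0"
    using range_to_int_mod_ring[where 'a='p] by (metis atLeastLessThan_iff rangeI)
  then have "of_nat (nat (to_int_mod_ring x)) = (of_int (to_int_mod_ring x) :: 'p mod_ring)"
    by simp
  also have "\<dots> = x"
    by (simp add: of_int_of_int_mod_ring)
  finally show ?thesis .
qed

lemma prod_linear_factors_mod_ring:
  "(\<Prod>x\<in>UNIV. [:- x, 1:]) = monom 1 CARD('p) - [:0, 1 :: 'p::prime_card mod_ring:]"
  using poly_monom_identity_mod_p[where 'a='p]
  by (simp add: monom_Suc one_pCons del: pCons_one)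

lemma pderiv_prod_linear_factors_mod_ring:
  "pderiv (\<Prod>x\<in>UNIV. [:- x, 1 :: 'p::prime_card mod_ring:]) = -1"
  unfolding prod_linear_factors_mod_ring
  by (simp add: pderiv_diff pderiv_monom pderiv_pCons)

text \<open>At \<open>z\<close> only the summand \<open>x = z\<close> survives, and its product is
  the derivative of \<open>X ^ p - X\<close> at \<open>z\<close>, namely -1. Both sides have degree
  below \<open>CARD('p)\<close>, so agreement at all points suffices.\<close>

lemma lagrange_interpolation_mod_ring:
  fixes P :: "'p::prime_card mod_ring poly"
  assumes "degree P < CARD('p)"
  shows "(\<Sum>x\<in>UNIV. smult (poly P x) (\<Prod>y\<in>UNIV - {x}. [:- y, 1:])) = - P" (is "?L = _")
proof (rule poly_eqI_degree[where A = UNIV])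
  fix z :: "'p mod_ring"
  have "poly (pderiv (\<Prod>x\<in>UNIV. [:- x, 1 :: 'p mod_ring:])) z
      = (\<Sum>x\<in>UNIV. poly (\<Prod>y\<in>UNIV - {x}. [:- y, 1:]) z)"
    by (simp add: pderiv_prod poly_sum pderiv_pCons)
  also have "\<dots> = (\<Sum>x\<in>UNIV. if x = z then poly (\<Prod>y\<in>UNIV - {z}. [:- y, 1:]) z else 0)"
    by (rule sum.cong) (auto simp: poly_prod)
  finally have *: "poly (\<Prod>y\<in>UNIV - {z}. [:- y, 1:]) z = -1"
    by (simp add: pderiv_prod_linear_factors_mod_ring del: pCons_one)
  have "poly ?L z = (\<Sum>x\<in>UNIV. poly P x * poly (\<Prod>y\<in>UNIV - {x}. [:- y, 1:]) z)"
    by (simp add: poly_sum)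
  also have "\<dots> = (\<Sum>x\<in>UNIV. if x = z then poly P z * poly (\<Prod>y\<in>UNIV - {z}. [:- y, 1:]) z else 0)"
    by (rule sum.cong) (auto simp: poly_prod)
  finally show "poly ?L z = poly (- P) z"
    using * by simp
next
  have "degree (\<Prod>y\<in>UNIV - {x}. [:- y, 1:]) \<le> CARD('p) - 1" for x :: "'p mod_ring"
    by (rule order.trans[OF degree_prod_sum_le]) (auto simp: card_Diff_singleton)
  then have "degree ?L \<le> CARD('p) - 1"
    by (intro degree_sum_le) (auto intro: order.trans[OF degree_smult_le])
  then show "degree ?L < card (UNIV :: 'p mod_ring set)"
    using assms by auto
qed (use assms in auto)

text \<open>Logarithmic derivative: F'/F is the sum of f(x) / (X - x). Multiplying by the product of
  all X - x clears denominators and leaves the interpolation sum; only the residues of the exponents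
  enter.\<close>

lemma pderiv_prod_power_linear_mod_ring:
  fixes P :: "'p::prime_card mod_ring poly"
  assumes "degree P < CARD('p)" and f: "\<And>x. of_nat (f x) = poly P x"
  defines "F \<equiv> \<Prod>x\<in>UNIV. [:- x, 1:] ^ f x"
  shows "pderiv F * (\<Prod>x\<in>UNIV. [:- x, 1:]) = - P * F"
proof -
  let ?D = "\<Prod>x\<in>UNIV. [:- x, 1 :: 'p mod_ring:]"
  have "prod (\<lambda>y. [:- y, 1:] ^ f y) (UNIV - {x}) * pderiv ([:- x, 1:] ^ f x) * ?D
      = smult (poly P x) (\<Prod>y\<in>UNIV - {x}. [:- y, 1:]) * F" for x
  proof -
    have D: "?D = [:- x, 1:] * (\<Prod>y\<in>UNIV - {x}. [:- y, 1:])"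
      and F: "F = [:- x, 1:] ^ f x * (\<Prod>y\<in>UNIV - {x}. [:- y, 1:] ^ f y)"
      unfolding F_def by (simp_all only: prod.remove[OF finite UNIV_I, of _ x])
    have "pderiv ([:- x, 1:] ^ f x) * [:- x, 1:] = smult (poly P x) ([:- x, 1:] ^ f x)"
    proof (cases "f x")
      case (Suc n)
      then have "poly P x = of_nat (Suc n)"
        using f[of x] by simp
      then show ?thesis
        unfolding Suc pderiv_power_Suc
        by (simp add: pderiv_pCons power_Suc2 del: power_Suc mult_pCons_left mult_pCons_right)
    qed (use f[of x] in simp)
    then have "W * pderiv ([:- x, 1:] ^ f x) * ([:- x, 1:] * R) = smult (poly P x) R * ([:- x, 1:] ^ f x * W)" for W R
      by (metis (no_types, lifting) mult.assoc mult.commute mult_smult_left)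
    then show ?thesis
      unfolding D F by (simp only:)
  qed
  then have "pderiv F * ?D
      = (\<Sum>x\<in>UNIV. smult (poly P x) (\<Prod>y\<in>UNIV - {x}. [:- y, 1:])) * F"
    unfolding F_def pderiv_prod sum_distrib_right by (intro sum.cong) (auto simp: F_def)
  then show ?thesis
    unfolding lagrange_interpolation_mod_ring[OF assms(1)] .
qed

theorem theorem3p5:
  fixes p :: nat and P :: "'p::prime_card mod_ring poly"
  assumes "CARD('p) = p"
    and "prime p"
    and "p > 7408848"
    and "degree P = (p - 1) div 2"
    and "(\<Sum>x\<in>UNIV. to_int_mod_ring (poly P x)) = int p"
  shows "lead_coeff P \<in> {1, - 1, of_nat ((p - 1) div 2), - of_nat ((p - 1) div 2)}"
proof -
  define m where "m = (p - 1) div 2"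
  define c where "c = lead_coeff P"
  define f where "f x = nat (to_int_mod_ring (poly P x))" for x
  define F where "F = (\<Prod>x\<in>UNIV. [:- x, 1:] ^ f x)"
  define D where "D = (\<Prod>x\<in>UNIV. [:- x, 1 :: 'p mod_ring:])"
  define h where "h = F - D"

  have "odd p"
    using assms(2,3) by (intro prime_odd_nat) auto
  then have p: "p = 2 * m + 1"
    unfolding m_def by presburger
  have m: "m > 1" and deg_P: "degree P = m"
    using p assms(3,4) by (auto simp: m_def)
  have c: "c \<noteq> 0"
    using deg_P m by (auto simp: c_def)
  have of_nat_p: "of_nat p = (0 :: 'p mod_ring)"
    using of_nat_card_eq_0[where 'a='p] assms(1) by simp
  have of_nat_nz: "of_nat i \<noteq> (0 :: 'p mod_ring)" if "0 < i" "i < p" for i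
    using that assms(1) of_nat_0_mod_ring_dvd[where 'a='p, of i] nat_dvd_not_less by blast
  have "2 * of_nat m + 1 = (of_nat p :: 'p mod_ring)"
    unfolding p by simp
  \<comment> \<open>Hence \<open>of_nat m\<close> is -1/2 in the field.\<close>
  then have two_m: "2 * of_nat m = (-1 :: 'p mod_ring)"
    unfolding of_nat_p by (rule eq_neg_iff_add_eq_0[THEN iffD2])

  have f: "of_nat (f x) = poly P x" for x
    by (simp add: f_def of_nat_to_int_mod_ring)
  have "int (f x) = to_int_mod_ring (poly P x)" for x
    using range_to_int_mod_ring[where 'a='p] unfolding f_def
    by (metis atLeastLessThan_iff int_nat_eq rangeI)
  then have "int (\<Sum>x\<in>UNIV. f x) = int p"
    using assms(5) by simp
  then have sum_f: "(\<Sum>x\<in>UNIV. f x) = p"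
    by (simp only: of_nat_eq_iff)

  have monic_F: "lead_coeff F = 1"
    unfolding F_def by (intro monic_prod monic_power) auto
  \<comment> \<open>The hypothesis on the sum of the values counts the linear factors of
    \<open>F\<close>, so \<open>F\<close> and \<open>D\<close> are monic of equal degree.\<close>
  have deg_F: "degree F = p"
    using sum_f unfolding F_def by (subst degree_prod_eq_sum_degree) (auto simp: degree_power_eq)
  have D_eq: "D = monom 1 p - [:0, 1:]"
    unfolding D_def using prod_linear_factors_mod_ring[where 'p='p] assms(1) by simp
  have D': "pderiv D = -1"
    unfolding D_def by (rule pderiv_prod_linear_factors_mod_ring)
  have monic_D: "lead_coeff D = 1"
    unfolding D_def by (intro monic_prod) auto
  have deg_D: "degree D = p"
    using assms(1) unfolding D_def by (subst degree_prod_eq_sum_degree) auto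
  have F'D: "pderiv F * D = - P * F"
    unfolding F_def D_def
    by (rule pderiv_prod_power_linear_mod_ring) (use f deg_P p assms(1) in auto)
  have nz: "F \<noteq> 0" "D \<noteq> 0" "P \<noteq> 0"
    using monic_F monic_D c c_def by auto
  then have "pderiv F \<noteq> 0"
    using F'D by auto
  then have deg_F': "degree (pderiv F) = m"
    using arg_cong[OF F'D, of degree] nz deg_P deg_F deg_D by (simp add: degree_mult_eq)
  have "lead_coeff (pderiv F) = - c"
    using arg_cong[OF F'D, of lead_coeff] monic_F monic_D by (simp add: lead_coeff_mult c_def)
  then have lead_F': "coeff (pderiv F) m = - c"
    by (simp add: deg_F')

  have coeff_h: "coeff h i = coeff F i" if "1 < i" "i < p" for i
    using that by (simp add: h_def D_eq coeff_pCons split: nat.split)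
  \<comment> \<open>For m + 1 < i < p, the coefficient i * F_i of F' vanishes and i is invertible;
    at i = p the leading terms of \<open>F\<close> and \<open>D\<close> cancel.\<close>
  have "degree h \<le> m + 1"
  proof (rule degree_le, intro allI impI)
    fix i assume i: "m + 1 < i"
    consider "i < p" | "i = p" | "p < i" by linarith
    then show "coeff h i = 0"
    proof cases
      case 1
      have "of_nat (Suc (i - 1)) * coeff F (Suc (i - 1)) = 0"
        unfolding coeff_pderiv[symmetric] using i deg_F' by (intro coeff_eq_0) auto
      then show ?thesis
        using 1 i of_nat_nz[of i] coeff_h[of i] by simp
    qed (use monic_F monic_D deg_F deg_D in \<open>auto simp: h_def coeff_eq_0\<close>)
  qed
  moreover have lead_h: "coeff h (m + 1) = - 2 * c"
  proof -
    \<comment> \<open>This is the leading coefficient of F'. Doubling it makes the factor 2 m + 2 =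
      1.\<close>
    have "(of_nat m + 1) * coeff h (m + 1) = - c"
      using lead_F' m p coeff_h[of "m + 1"] by (simp add: coeff_pderiv add.commute)
    then have "2 * ((of_nat m + 1) * coeff h (m + 1)) = - 2 * c"
      by simp
    then have "(2 * of_nat m + 2) * coeff h (m + 1) = - 2 * c"
      by (simp add: algebra_simps)
    then show ?thesis
      by (simp add: two_m)
  qed
  moreover have two_nz: "(2 :: 'p mod_ring) \<noteq> 0"
    using of_nat_nz[of 2] p m by simp
  ultimately have deg_h: "degree h = m + 1"
    using c by (intro antisym le_degree) auto

  have hF': "h * pderiv F = F * (pderiv F + P)"
    using F'D unfolding h_def by (simp add: algebra_simps)
  obtain a where a: "pderiv F + P = [:a:]"
  proof (cases "pderiv F + P = 0")
    case False
    \<comment> \<open>The degrees (m + 1) + m already exhaust that of \<open>F\<close>, so the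
      cofactor is constant.\<close>
    have "degree (h * pderiv F) = p"
      using deg_h deg_F' p \<open>pderiv F \<noteq> 0\<close> by (subst degree_mult_eq) auto
    then have "degree (pderiv F + P) = 0"
      using hF' False nz deg_F by (simp add: degree_mult_eq)
    then show ?thesis
      using that by (metis degree_eq_zeroE)
  qed (use that[of 0] in simp)
  have "lead_coeff h * lead_coeff (pderiv F) = lead_coeff F * lead_coeff [:a:]"
    unfolding a[symmetric] lead_coeff_mult[symmetric] hF' ..
  then have a_c: "a = 2 * c\<^sup>2"
    unfolding monic_F deg_h deg_F' lead_h lead_F' by (simp add: power2_eq_square mult.assoc)
  have F': "pderiv F = [:a:] - P"
    using a by (simp add: eq_diff_eq)

  have hP': "h * pderiv P = ([:a:] - P) * (1 - P)"
  proof -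
    define q where "q = [:a:]"
    have q': "pderiv q = 0"
      by (simp add: q_def pderiv_pCons)
    \<comment> \<open>Derivatives of \<open>D\<close> and \<open>F\<close> are then replaced by -1
      and \<open>q - P\<close>.\<close>
    have "pderiv ((q - P) * D) = pderiv (- P * F)"
      using F'D unfolding F' q_def by simp
    then have "- (q - P) - D * pderiv P = - F * pderiv P - P * (q - P)"
      unfolding pderiv_mult pderiv_diff pderiv_minus D' F' q' q_def[symmetric]
      by (simp add: algebra_simps)
    then show ?thesis
      unfolding h_def q_def[symmetric] by (simp add: algebra_simps)
  qed
  have critical: "(2 + 2 * a - 3 * poly P x) * poly (pderiv P) x = 0"
    and range_P: "poly P x = 1 \<or> poly P x = a" if x: "poly P x \<noteq> 0" for x
  proof -
    \<comment> \<open>A positive exponent makes \<open>x\<close> a root of \<open>F\<close>; every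
      point is a root of \<open>D\<close>.\<close>
    have "f x > 0"
      using f[of x] x by (cases "f x") auto
    then have "poly F x = 0"
      by (auto simp: F_def poly_prod prod_zero_iff intro!: bexI[of _ x])
    moreover have "poly D x = 0"
      by (auto simp: D_def poly_prod prod_zero_iff intro!: bexI[of _ x])
    ultimately have h0: "poly h x = 0"
      by (simp add: h_def)
    show "poly P x = 1 \<or> poly P x = a"
      using arg_cong[OF hP', of "\<lambda>q. poly q x"] h0 by auto
    have h': "poly (pderiv h) x = 1 + a - poly P x"
      by (simp add: h_def pderiv_diff D' F')
    \<comment> \<open>The term with the second derivative of \<open>P\<close> drops out because
      \<open>h\<close> vanishes at \<open>x\<close>.\<close>
    have "poly (pderiv (h * pderiv P)) x = poly (pderiv (([:a:] - P) * (1 - P))) x"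
      by (simp only: hP')
    then have "poly (pderiv P) x * (1 + a - poly P x)
        = - ((a - poly P x) * poly (pderiv P) x) - (1 - poly P x) * poly (pderiv P) x"
      unfolding pderiv_mult pderiv_diff by (simp add: pderiv_pCons h0 h')
    then show "(2 + 2 * a - 3 * poly P x) * poly (pderiv P) x = 0"
      by (simp add: algebra_simps)
  qed

  have "a = 2 \<or> 2 * a = 1"
  proof (rule ccontr)
    assume *: "\<not> (a = 2 \<or> 2 * a = 1)"
    \<comment> \<open>The factor 2 + 2 a - 3 P(x) is 2 a - 1 when P(x) = 1 and 2 - a when P(x) =
      a.\<close>
    have "poly (pderiv P) x = 0" if "poly P x \<noteq> 0" for x
      using critical[OF that] range_P[OF that] * by auto
    then have "- {x. poly P x = 0} \<subseteq> {x. poly (pderiv P) x = 0}"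
      by auto
    then have "card (- {x. poly P x = 0}) \<le> card {x. poly (pderiv P) x = 0}"
      by (intro card_mono) auto
    \<comment> \<open>This coefficient is m c, and 0 < m < p.\<close>
    moreover have "coeff (pderiv P) (m - 1) \<noteq> 0"
      using m c deg_P of_nat_nz[of m] p by (simp add: coeff_pderiv c_def)
    then have "pderiv P \<noteq> 0"
      by auto
    then have "card {x. poly (pderiv P) x = 0} \<le> m"
      using card_poly_roots_bound[of "pderiv P"] degree_pderiv_le[of P] deg_P by linarith
    moreover have "card {x. poly P x = 0} \<le> m"
      using card_poly_roots_bound[OF nz(3)] deg_P by simp
    moreover have "card (- {x. poly P x = 0}) = p - card {x. poly P x = 0}"
      using assms(1) by (simp add: Compl_eq_Diff_UNIV card_Diff_subset)
    ultimately show False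
      using p by linarith
  qed
  then show ?thesis
  proof
    assume "a = 2"
    then have "c\<^sup>2 = 1"
      using a_c two_nz by simp
    then show ?thesis
      by (auto simp: power2_eq_1_iff c_def)
  next
    assume "2 * a = 1"
    \<comment> \<open>Here 2 a = 4 c^2. Writing 1 as -2 m then lets the factor 2 cancel.\<close>
    then have "(2 * c)\<^sup>2 = 1"
      using a_c by (simp add: power2_eq_square algebra_simps)
    then have "2 * c = 1 \<or> 2 * c = - 1"
      by (simp only: power2_eq_1_iff)
    then have "2 * c = 2 * - of_nat m \<or> 2 * c = 2 * of_nat m"
      using two_m by simp
    then have "c = - of_nat m \<or> c = of_nat m"
      using two_nz by (simp only: mult_cancel_left simp_thms)
    then show ?thesis
      by (auto simp: c_def m_def)
  qed
qed

end
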